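(* Let $q$ be a prime power, let $\ell, N$ be positive integers, and let $n = \ell N$ be a sum-rank length partition with equal sublengths $N = n_1 = \cdots = n_\ell$ (extension degree $m=1$). Let $r \geq N$ be such that $N$ divides $r$. If $\mathcal{C} \subseteq \mathbb{F}_q^n$ is a (nonzero) proper sum-rank Hamming code with $r = n - \dim(\mathcal{C})$, then $\mathcal{C}$ is a perfect code for this sum-rank metric. In other words, if $\mathcal{B}_t = \{\mathbf{c} \in \mathbb{F}_q^n \mid \mathrm{wt}_{SR}(\mathbf{c}) \leq t\}$ denotes the ball centered at the origin with radius $t > 0$, then $$ |\mathcal{C}| \cdot |\mathcal{B}_1| = |\mathbb{F}_q^n|, $$ where $1 = \lfloor (\mathrm{d}_{SR}(\mathcal{C}) - 1)/2 \rfloor$ is the sum-rank error-correcting capability of $\mathcal{C}$.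
   Context: Sum-rank metric for $m=1$: for $\mathbf{c} = (\mathbf{c}^{(1)}, \ldots, \mathbf{c}^{(\ell)}) \in \mathbb{F}_q^n$ with $\mathbf{c}^{(i)} \in \mathbb{F}_q^{N}$, the sum-rank weight is $\mathrm{wt}_{SR}(\mathbf{c}) = \sum_{i=1}^\ell \mathrm{Rk}(\mathbf{c}^{(i)})$, where $\mathbf{c}^{(i)}$ is viewed as a $1\times N$ matrix over $\mathbb{F}_q$ (so the weight is the number of nonzero blocks). For a nonzero linear code (subspace) $\mathcal{C}$, $\mathrm{d}_{SR}(\mathcal{C}) = \min\{\mathrm{wt}_{SR}(\mathbf{c}) \mid \mathbf{c} \in \mathcal{C}\setminus\{\mathbf{0}\}\}$. Proper sum-rank Hamming code ($m=1$): a linear code $\mathcal{C} \subseteq \mathbb{F}_q^n$, $n = \ell N$, of redundancy $r = n - \dim(\mathcal{C})$, such that $\mathrm{d}_{SR}(\mathcal{C}) \geq 3$ and there is no linear code $\mathcal{C}' \subseteq \mathbb{F}_q^{n'}$ with $\mathrm{d}_{SR}(\mathcal{C}') \geq 3$ and $n' - \dim(\mathcal{C}') = r$ for a partition $n' = \ell' N$ into $\ell'$ blocks of the same length $N$ with $\ell' > \ell$. *)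

theory Defs
  imports "Jordan_Normal_Form.DL_Rank"
begin

definition linear_code :: "nat \<Rightarrow> 'a::field vec set \<Rightarrow> bool" where
  "linear_code n C \<longleftrightarrow> VectorSpace.subspace class_ring C (module_vec TYPE('a) n)"

definition code_dim :: "nat \<Rightarrow> 'a::field vec set \<Rightarrow> nat" where
  "code_dim n C = vectorspace.dim class_ring ((module_vec TYPE('a) n)\<lparr>carrier := C\<rparr>)"

text \<open>The natural-number subtraction never truncates for a linear code of length \<open>n\<close>.\<close>

definition redundancy :: "nat \<Rightarrow> 'a::field vec set \<Rightarrow> nat" where
  "redundancy n C = n - code_dim n C"

text \<open>
  Throughout, \<open>N\<close> is the common block length and \<open>l\<close> the number of blocks; blocks are numbered
  from 0, so that block \<open>i\<close> of a vector of length \<open>l * N\<close> occupies the coordinates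
  \<open>i * N, \<dots>, i * N + N - 1\<close>.
\<close>

definition sr_block :: "nat \<Rightarrow> 'a vec \<Rightarrow> nat \<Rightarrow> 'a vec" where
  "sr_block N c i = vec N (\<lambda>j. c $ (i * N + j))"

text \<open>
  For extension degree 1, the matrix of a block is its \<open>1 \<times> N\<close> row matrix. The parameter of
  \<open>vec_space.rank\<close> is the number of rows.
\<close>

definition sr_weight :: "nat \<Rightarrow> nat \<Rightarrow> 'a::field vec \<Rightarrow> nat" where
  "sr_weight N l c = (\<Sum>i<l. vec_space.rank 1 (mat_of_row (sr_block N c i)))"

text \<open>
  The minimum is specified only for a nonzero code: \<open>Min {}\<close> is unspecified. Finiteness of the field
  makes the set of weights finite.
\<close>

definition sr_distance :: "nat \<Rightarrow> nat \<Rightarrow> 'a::{field,finite} vec set \<Rightarrow> nat" where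
  "sr_distance N l C = Min (sr_weight N l ` (C - {0\<^sub>v (l * N)}))"

definition nonzero_linear_code :: "nat \<Rightarrow> 'a::field vec set \<Rightarrow> bool" where
  "nonzero_linear_code n C \<longleftrightarrow> linear_code n C \<and> C \<noteq> {0\<^sub>v n}"

definition proper_sr_hamming_code :: "nat \<Rightarrow> nat \<Rightarrow> 'a::{field,finite} vec set \<Rightarrow> bool" where
  "proper_sr_hamming_code N l C \<longleftrightarrow>
     nonzero_linear_code (l * N) C \<and> 3 \<le> sr_distance N l C \<and>
     \<not> (\<exists>l' (C' :: 'a vec set). l < l' \<and> nonzero_linear_code (l' * N) C' \<and>
          3 \<le> sr_distance N l' C' \<and> redundancy (l' * N) C' = redundancy (l * N) C)"

definition sr_ball :: "nat \<Rightarrow> nat \<Rightarrow> nat \<Rightarrow> 'a::field vec set" where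
  "sr_ball N l t = {c \<in> carrier_vec (l * N). sr_weight N l c \<le> t}"

definition sr_correction_capability :: "nat \<Rightarrow> nat \<Rightarrow> 'a::{field,finite} vec set \<Rightarrow> nat" where
  "sr_correction_capability N l C = (sr_distance N l C - 1) div 2"

definition sr_perfect :: "nat \<Rightarrow> nat \<Rightarrow> 'a::{field,finite} vec set \<Rightarrow> bool" where
  "sr_perfect N l C \<longleftrightarrow>
     card C * card (sr_ball N l (sr_correction_capability N l C) :: 'a vec set) =
     card (carrier_vec (l * N) :: 'a vec set)"

end

theory Submission
  imports Defs "HOL-Algebra.Algebraic_Closure_Type" "Berlekamp_Zassenhaus.Berlekamp_Type_Based"
begin

text \<open>
  Let \<open>Q = q ^ N\<close>, \<open>r = N * s\<close> and \<open>L = (Q ^ s - 1) / (Q - 1)\<close>. Since \<open>d \<ge> 3\<close>, the balls of radius 1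
  around the codewords are disjoint; a ball has \<open>1 + l * (Q - 1)\<close> elements, whence \<open>l \<le> L\<close>, with equality
  iff the code is perfect. If \<open>l < L\<close>, properness is violated by a code with \<open>L\<close> blocks: the space of
  dimension \<open>s\<close> over the field with \<open>Q\<close> elements has \<open>L\<close> lines, which are pairwise independent
  \<open>N\<close>-dimensional spaces over the field with \<open>q\<close> elements, and the parity-check matrix whose blocks
  are bases of these lines defines a code of redundancy \<open>r\<close> and minimum distance at least 3. Finally,
  in a perfect code a vector of weight 2 is at distance at most 1 from a nonzero codeword, so \<open>d = 3\<close>.
\<close>

section \<open>Finite extensions of finite fields\<close>

text \<open>Multiplication by a nonzero \<open>x\<close> permutes the nonzero elements of the field,
  so it leaves their product unchanged while scaling it by \<open>x\<close> to the order of the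
  field minus 1.\<close>

lemma power_card_UNIV_eq_same:
  fixes x :: "'a :: {field,finite}"
  shows "x ^ card (UNIV :: 'a set) = x"
proof (cases "x = 0")
  case False
  have "x * (\<Prod>y\<in>UNIV-{0}. x * y) = x * x ^ (card (UNIV :: 'a set) - 1) * \<Prod>(UNIV-{0})"
    by (simp add: prod.distrib mult_ac)
  also have "x * x ^ (card (UNIV :: 'a set) - 1) = x ^ Suc (card (UNIV :: 'a set) - 1)"
    by (subst power_Suc) auto
  also have "Suc (card (UNIV :: 'a set) - 1) = card (UNIV :: 'a set)"
    using finite_UNIV_card_ge_0[where ?'a = 'a] by simp
  also have "(\<Prod>y\<in>UNIV-{0}. x * y) = (\<Prod>y\<in>UNIV-{0}. y)"
    by (rule prod.reindex_bij_witness[of _ "\<lambda>y. y / x" "\<lambda>y. x * y"]) (use False in auto)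
  finally show ?thesis
    by simp
qed (use finite_UNIV_card_ge_0[where ?'a = 'a] in auto)

lemma card_UNIV_ge_2: "2 \<le> card (UNIV :: 'a :: {field,finite} set)"
  using card_mono[of "UNIV :: 'a set" "{0, 1}"] by simp

text \<open>The polynomial \<open>(X + 1) ^ q - X ^ q - 1\<close> has degree less than \<open>q\<close> but vanishes at all \<open>q\<close> elements of the
  field, so its coefficients are zero. This replaces the fact that \<open>q\<close> is a prime power.\<close>

lemma of_nat_card_UNIV_choose_eq_0:
  fixes k :: nat
  assumes "0 < k" "k < card (UNIV :: 'a :: {field,finite} set)"
  shows "of_nat (card (UNIV :: 'a set) choose k) = (0 :: 'a)"
proof -
  let ?q = "card (UNIV :: 'a set)"
  define p :: "'a poly" where "p = (\<Sum>i\<in>{1..<?q}. Polynomial.monom (of_nat (?q choose i)) i)"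
  have split: "{..?q} = insert 0 (insert ?q {1..<?q})" and q: "0 < ?q"
    using card_UNIV_ge_2[where 'a='a] by auto
  have "poly p x = 0" for x
  proof -
    \<comment> \<open>The end terms of the expansion are \<open>1\<close> and
      \<open>x ^ ?q = x\<close>, so the inner terms, which form \<open>poly p x\<close>, sum to
      0.\<close>
    have "x + 1 = (x + 1) ^ ?q"
      by (simp add: power_card_UNIV_eq_same)
    also have "\<dots> = (\<Sum>i\<le>?q. of_nat (?q choose i) * x ^ i * 1 ^ (?q - i))"
      by (rule binomial_ring)
    also have "\<dots> = 1 + (x ^ ?q + poly p x)"
      using q unfolding split p_def by (simp add: poly_sum poly_monom)
    finally show ?thesis by (simp add: power_card_UNIV_eq_same)
  qed
  then have roots: "{x. poly p x = 0} = UNIV" by auto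
  have deg: "Polynomial.degree p < ?q"
    unfolding p_def using card_UNIV_ge_2[where 'a='a]
    by (intro degree_sum_less) (auto intro: le_less_trans[OF degree_monom_le])
  have "p = 0"
    using card_poly_roots_bound[of p] deg unfolding roots by (cases "p = 0") auto
  then have "0 = Polynomial.coeff p k" by simp
  also have "\<dots> = (\<Sum>i\<in>{1..<?q}. if i = k then of_nat (?q choose i) else 0)"
    by (simp add: p_def coeff_sum)
  also have "\<dots> = of_nat (?q choose k)"
    using assms by simp
  finally show ?thesis by simp
qed

text \<open>The inner binomial coefficients vanish in the base field, hence in its closure, which
  makes the \<open>q\<close>-th power additive; the rest is iteration.\<close>

lemma alg_closure_frobenius_add:
  fixes x y :: "'a :: {field,finite} alg_closure"
  shows "(x + y) ^ (card (UNIV :: 'a set) ^ m) =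
    x ^ (card (UNIV :: 'a set) ^ m) + y ^ (card (UNIV :: 'a set) ^ m)"
proof (induction m)
  case (Suc m)
  let ?q = "card (UNIV :: 'a set)"
  have split: "{..?q} = insert 0 (insert ?q {1..<?q})" and q: "0 < ?q"
    using card_UNIV_ge_2[where 'a='a] by auto
  have zero: "of_nat (?q choose i) = (0 :: 'a alg_closure)" if "i \<in> {1..<?q}" for i
    using of_nat_card_UNIV_choose_eq_0[of i, where 'a='a] that
    by (simp add: Suc_le_eq flip: to_ac_of_nat)
  have frob: "(u + v) ^ ?q = u ^ ?q + v ^ ?q" for u v :: "'a alg_closure"
    unfolding binomial_ring[of u v] split using q zero by simp
  show ?case
    unfolding power_Suc2 power_mult Suc frob ..
qed simp

section \<open>The subfield of order \<open>q ^ m\<close>\<close>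

text \<open>For \<open>m > 0\<close> this is the extension of degree \<open>m\<close> of the base
  field, taken inside the algebraic closure, where its defining polynomial splits. For
  \<open>m = 0\<close> it is the whole closure.\<close>

definition frobenius_fixed :: "nat \<Rightarrow> 'a :: {field,finite} alg_closure set" where
  "frobenius_fixed m = {x. x ^ (card (UNIV :: 'a set) ^ m) = x}"

lemma frobenius_fixed_closed:
  fixes x y :: "'a :: {field,finite} alg_closure"
  assumes "x \<in> frobenius_fixed m" "y \<in> frobenius_fixed m"
  shows "x + y \<in> frobenius_fixed m" "x * y \<in> frobenius_fixed m"
  using assms by (simp_all add: frobenius_fixed_def alg_closure_frobenius_add power_mult_distrib)

lemma to_ac_in_frobenius_fixed [simp]: "to_ac (x :: 'a :: {field,finite}) \<in> frobenius_fixed m"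
proof -
  have "x ^ (card (UNIV :: 'a set) ^ m) = x"
    by (induction m) (simp_all add: power_mult power_card_UNIV_eq_same)
  then show ?thesis
    by (simp add: frobenius_fixed_def flip: to_ac_power)
qed

lemma zero_one_in_frobenius_fixed [simp]:
  "0 \<in> (frobenius_fixed m :: 'a :: {field,finite} alg_closure set)"
  "1 \<in> (frobenius_fixed m :: 'a :: {field,finite} alg_closure set)"
  using to_ac_in_frobenius_fixed[of "0 :: 'a" m] to_ac_in_frobenius_fixed[of "1 :: 'a" m] by simp_all

lemma sum_in_frobenius_fixed:
  "(\<And>i. i \<in> I \<Longrightarrow> f i \<in> frobenius_fixed m) \<Longrightarrow> sum f I \<in> frobenius_fixed m"
  by (induction I rule: infinite_finite_induct) (simp_all add: frobenius_fixed_closed)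

text \<open>The polynomial \<open>X ^ q ^ m - X\<close> has derivative \<open>-1\<close>, hence no multiple roots.\<close>

lemma card_frobenius_fixed:
  assumes "m > 0"
  shows "card (frobenius_fixed m :: 'a :: {field,finite} alg_closure set) = card (UNIV :: 'a set) ^ m"
proof -
  let ?q = "card (UNIV :: 'a set)"
  let ?Q = "?q ^ m"
  define p :: "'a alg_closure poly" where "p = Polynomial.monom 1 ?Q - Polynomial.monom 1 1"
  have "?q ^ 1 \<le> ?Q"
    using assms card_UNIV_ge_2[where 'a='a] by (intro power_increasing) auto
  then have Q: "1 < ?Q" using card_UNIV_ge_2[where 'a='a] by simp
  have deg: "Polynomial.degree p = ?Q"
    using Q unfolding p_def diff_conv_add_uminus
    by (subst degree_add_eq_left) (simp_all add: degree_monom_eq)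
  then have "p \<noteq> 0" using Q by auto
  have lead: "Polynomial.coeff p ?Q = 1"
    using Q by (simp add: p_def)
  obtain A where A: "size A = ?Q" "p = (\<Prod>x\<in>#A. [:-x, 1:])"
    using alg_closed_imp_factorization[OF \<open>p \<noteq> 0\<close>] deg lead by auto
  \<comment> \<open>The vanishing of the binomial coefficient with \<open>k = 1\<close> says that
    \<open>?q\<close> is zero in the field; this removes the derivative of the term of degree
    \<open>?Q\<close>.\<close>
  have "of_nat ?q = to_ac (of_nat (?q choose 1) :: 'a)"
    by simp
  also have "\<dots> = 0"
    using card_UNIV_ge_2[where 'a='a] by (subst of_nat_card_UNIV_choose_eq_0) auto
  finally have "of_nat ?q = (0 :: 'a alg_closure)" .
  then have "pderiv p = - 1"
    using assms by (simp add: p_def pderiv_diff pderiv_monom power_0_left)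
  \<comment> \<open>A factor occurring twice would give a common root of \<open>p\<close> and its
    derivative, which is the constant \<open>- 1\<close>.\<close>
  have count: "count A x \<le> 1" for x
  proof (rule ccontr)
    assume "\<not> count A x \<le> 1"
    then have "{#x, x#} \<subseteq># A"
      by (auto simp: subseteq_mset_def)
    then obtain B where "A = {#x, x#} + B"
      by (auto simp: mset_subset_eq_exists_conv)
    then have "p = [:-x, 1:] * ([:-x, 1:] * (\<Prod>x\<in>#B. [:-x, 1:]))"
      using A(2) by simp
    then have "poly (pderiv p) x = 0"
      by (simp add: pderiv_mult del: mult_pCons_left)
    then show False using \<open>pderiv p = - 1\<close> by simp
  qed
  have "frobenius_fixed m = {x. poly p x = 0}"
    by (auto simp: frobenius_fixed_def p_def poly_monom)
  also have "\<dots> = set_mset A"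
    unfolding A(2) by (auto simp: poly_prod_mset prod_mset_zero_iff)
  finally have "card (frobenius_fixed m :: 'a alg_closure set) = card (set_mset A)" by simp
  also have "\<dots> = size A"
  proof -
    have "A = mset_set (set_mset A)"
      by (rule multiset_eqI)
        (metis count count_mset_set(1,3) count_greater_zero_iff finite_set_mset le_antisym less_eq_Suc_le One_nat_def not_in_iff)
    then show ?thesis by (metis size_mset_set)
  qed
  finally show ?thesis using A(1) by simp
qed

lemma finite_frobenius_fixed:
  assumes "m > 0"
  shows "finite (frobenius_fixed m :: 'a :: {field,finite} alg_closure set)"
  by (rule card_ge_0_finite) (simp add: card_frobenius_fixed[OF assms] finite_UNIV_card_ge_0)

text \<open>Greedy choice by counting: \<open>k < m\<close> elements have at most
  \<open>q ^ k < q ^ m\<close> combinations, so some element of the fixed field lies outside their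
  span. The general \<open>k\<close> serves the induction; the application takes
  \<open>k = m\<close>.\<close>

lemma exists_independent_in_frobenius_fixed:
  assumes "k \<le> m" "m > 0"
  shows "\<exists>b. (\<forall>j<k. b j \<in> frobenius_fixed m) \<and>
    (\<forall>x :: nat \<Rightarrow> 'a :: {field,finite}. (\<Sum>j<k. to_ac (x j) * b j) = 0 \<longrightarrow> (\<forall>j<k. x j = 0))"
  using assms(1)
proof (induction k)
  case (Suc k)
  then obtain b where b: "\<And>j. j < k \<Longrightarrow> b j \<in> frobenius_fixed m"
    "\<And>x :: nat \<Rightarrow> 'a. (\<Sum>j<k. to_ac (x j) * b j) = 0 \<Longrightarrow> \<forall>j<k. x j = 0"
    by auto
  define S where "S = (\<lambda>x :: nat \<Rightarrow> 'a. \<Sum>j<k. to_ac (x j) * b j) ` ({..<k} \<rightarrow>\<^sub>E UNIV)"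
  have fin: "finite ({..<k} \<rightarrow>\<^sub>E (UNIV :: 'a set))" by (intro finite_PiE) auto
  have "card S \<le> card ({..<k} \<rightarrow>\<^sub>E (UNIV :: 'a set))"
    unfolding S_def by (rule card_image_le[OF fin])
  also have "\<dots> = card (UNIV :: 'a set) ^ k" by (simp add: card_PiE)
  also have "\<dots> < card (UNIV :: 'a set) ^ m"
    using Suc.prems card_UNIV_ge_2[where 'a='a] by (intro power_strict_increasing) auto
  also have "\<dots> = card (frobenius_fixed m :: 'a alg_closure set)"
    by (simp add: card_frobenius_fixed[OF assms(2)])
  finally have "\<not> (frobenius_fixed m :: 'a alg_closure set) \<subseteq> S"
    using card_mono[of S "frobenius_fixed m"] fin by (auto simp: S_def)
  then obtain c where c: "c \<in> frobenius_fixed m" "c \<notin> S" by blast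
  have "\<forall>j<Suc k. x j = 0" if "(\<Sum>j<Suc k. to_ac (x j) * (b(k := c)) j) = 0" for x :: "nat \<Rightarrow> 'a"
  proof -
    have "(\<Sum>j<Suc k. to_ac (x j) * (b(k := c)) j) = (\<Sum>j<k. to_ac (x j) * b j) + to_ac (x k) * c"
      by simp
    with that have sum0: "(\<Sum>j<k. to_ac (x j) * b j) + to_ac (x k) * c = 0" by simp
    \<comment> \<open>Otherwise the relation could be solved for \<open>c\<close>, placing it in the
      span \<open>S\<close>.\<close>
    have "x k = 0"
    proof (rule ccontr)
      assume "x k \<noteq> 0"
      have "(\<Sum>j<k. to_ac ((\<lambda>j\<in>{..<k}. - x j / x k) j) * b j) = (\<Sum>j<k. - (inverse (to_ac (x k)) * (to_ac (x j) * b j)))"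
        by (intro sum.cong) (auto simp: field_simps)
      also have "\<dots> = - (inverse (to_ac (x k)) * (\<Sum>j<k. to_ac (x j) * b j))"
        by (simp add: sum_negf sum_distrib_left)
      also have "(\<Sum>j<k. to_ac (x j) * b j) = - (to_ac (x k) * c)"
        using sum0 by (simp add: eq_neg_iff_add_eq_0)
      also have "- (inverse (to_ac (x k)) * - (to_ac (x k) * c)) = c"
        using \<open>x k \<noteq> 0\<close> by simp
      finally have "c \<in> S" unfolding S_def
        by (intro image_eqI[where x = "\<lambda>j\<in>{..<k}. - x j / x k"]) simp_all
      with c(2) show False by simp
    qed
    then have "(\<Sum>j<k. to_ac (x j) * b j) = 0" using sum0 by simp
    then show ?thesis using b(2) \<open>x k = 0\<close> less_Suc_eq by auto
  qed
  moreover have "\<forall>j<Suc k. (b(k := c)) j \<in> frobenius_fixed m"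
    using b(1) c(1) by (auto simp: less_Suc_eq)
  ultimately show ?case by blast
qed auto

section \<open>Linear codes and the sum-rank weight\<close>

lemma linear_code_iff:
  "linear_code n (C :: 'a::field vec set) \<longleftrightarrow>
    C \<subseteq> carrier_vec n \<and> 0\<^sub>v n \<in> C \<and> (\<forall>x\<in>C. \<forall>y\<in>C. x + y \<in> C) \<and> (\<forall>a. \<forall>x\<in>C. a \<cdot>\<^sub>v x \<in> C)"
  unfolding linear_code_def VectorSpace.subspace_def submodule_def module_vec_simps
  by (auto simp: vec_vs vec_module)

lemma linear_codeD:
  assumes "linear_code n (C :: 'a::field vec set)"
  shows "C \<subseteq> carrier_vec n" "0\<^sub>v n \<in> C"
    and "\<And>x y. x \<in> C \<Longrightarrow> y \<in> C \<Longrightarrow> x + y \<in> C"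
    and "\<And>a x. x \<in> C \<Longrightarrow> a \<cdot>\<^sub>v x \<in> C"
    and "\<And>x y. x \<in> C \<Longrightarrow> y \<in> C \<Longrightarrow> x - y \<in> C"
proof -
  show 1: "C \<subseteq> carrier_vec n" "0\<^sub>v n \<in> C"
    and add: "\<And>x y. x \<in> C \<Longrightarrow> y \<in> C \<Longrightarrow> x + y \<in> C"
    and smult: "\<And>a x. x \<in> C \<Longrightarrow> a \<cdot>\<^sub>v x \<in> C"
    using assms by (simp_all add: linear_code_iff)
  show "x - y \<in> C" if "x \<in> C" "y \<in> C" for x y
  proof -
    have "x + (-1) \<cdot>\<^sub>v y \<in> C" using that add smult by blast
    moreover have "x + (-1) \<cdot>\<^sub>v y = x - y"
      using that 1 by (intro eq_vecI) auto
    ultimately show ?thesis by simp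
  qed
qed

text \<open>Coordinates with respect to a basis identify \<open>C\<close> with the functions from
  the basis to the field. This turns dimensions into cardinalities, the form in which the later
  estimates are made.\<close>

lemma card_linear_code:
  assumes "linear_code n (C :: 'a::{field,finite} vec set)"
  shows "card C = card (UNIV :: 'a set) ^ code_dim n C"
proof -
  interpret V: vectorspace class_ring "module_vec TYPE('a) n" by (rule vec_vs)
  let ?W = "(module_vec TYPE('a) n)\<lparr>carrier := C\<rparr>"
  interpret W: vectorspace class_ring ?W
    using assms V.subspace_is_vs unfolding linear_code_def by blast
  have fin: "finite C"
    using linear_codeD(1)[OF assms] finite_carrier_vec finite_subset by blast
  \<comment> \<open>The finite set \<open>C\<close> generates itself.\<close>
  have "W.fin_dim"
    unfolding W.fin_dim_def using fin W.in_own_span[of C] W.span_is_subset2[of C]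
    by (intro exI[of _ C]) simp
  then obtain B where B: "finite B" "W.basis B"
    using W.finite_basis_exists by blast
  have BC: "B \<subseteq> C" using B(2) by (simp add: W.basis_def)
  have ex1: "\<forall>v\<in>C. \<exists>!a. a \<in> B \<rightarrow>\<^sub>E UNIV \<and> W.lincomb a B = v"
    using W.basis_criterion[OF B(1)] B(2) BC unfolding class_ring_simps by simp
  have closed: "W.lincomb a B \<in> C" for a
    using W.lincomb_closed[of B a] BC unfolding class_ring_simps by simp
  have "bij_betw (\<lambda>a. W.lincomb a B) (B \<rightarrow>\<^sub>E UNIV) C"
  proof (rule bij_betwI')
    fix a b :: "'a vec \<Rightarrow> 'a" assume "a \<in> B \<rightarrow>\<^sub>E UNIV" "b \<in> B \<rightarrow>\<^sub>E UNIV"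
    then show "W.lincomb a B = W.lincomb b B \<longleftrightarrow> a = b"
      using ex1 closed[of b] by metis
  qed (use ex1 closed in metis)+
  then have "card C = card (B \<rightarrow>\<^sub>E (UNIV :: 'a set))"
    by (simp add: bij_betw_same_card)
  also have "\<dots> = card (UNIV :: 'a set) ^ card B"
    using B(1) by (simp add: card_PiE)
  also have "card B = code_dim n C"
    unfolding code_dim_def using W.dim_basis[OF B] by simp
  finally show ?thesis .
qed

section \<open>The weight as the number of nonzero blocks\<close>

text \<open>The entries \<open>1 * v $ j\<close> have product form, so the rank is at most 1; a
  column with a nonzero entry is linearly independent, so the rank of a nonzero row is at least
  1.\<close>

lemma rank_mat_of_row:
  assumes "v \<in> carrier_vec N"
  shows "vec_space.rank 1 (mat_of_row (v :: 'a::field vec)) = (if v = 0\<^sub>v N then 0 else 1)"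
proof -
  interpret vec_space "TYPE('a)" 1 .
  have A: "mat_of_row v \<in> carrier_mat 1 N" using assms by auto
  show ?thesis
  proof (cases "v = 0\<^sub>v N")
    case True
    then have "mat_of_row v = 0\<^sub>m 1 N" by (intro eq_matI) auto
    then show ?thesis using True rank_0I[of N] by simp
  next
    case False
    then obtain j where j: "j < N" "v $ j \<noteq> 0"
      using assms by (metis carrier_vecD eq_vecI index_zero_vec)
    have "rank (mat_of_row v) \<le> 1"
      by (rule rank_le_1_product_entries[OF A, of "\<lambda>_. 1" "\<lambda>j. v $ j"]) (use assms in auto)
    moreover have "card {col (mat_of_row v) j} \<le> rank (mat_of_row v)"
    proof (rule rank_ge_card_indpt[OF A])
      show "{col (mat_of_row v) j} \<subseteq> set (cols (mat_of_row v))"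
        using j assms by (auto simp: cols_def)
      show "lin_indpt {col (mat_of_row v) j}"
      proof (rule finite_lin_indpt2)
        fix a assume "lincomb a {col (mat_of_row v) j} = 0\<^sub>v 1"
        then have "lincomb a {col (mat_of_row v) j} $ 0 = 0" by simp
        then show "\<forall>w\<in>{col (mat_of_row v) j}. a w = 0"
          using j assms by (subst (asm) lincomb_index) auto
      qed (use assms in \<open>auto intro!: carrier_vecI\<close>)
    qed
    ultimately show ?thesis using False by simp
  qed
qed

lemma sr_block_carrier [simp]: "sr_block N c i \<in> carrier_vec N"
  by (simp add: sr_block_def)

lemma block_index_less: "i < l \<Longrightarrow> j < N \<Longrightarrow> i * N + j < l * (N :: nat)"
proof -
  assume "i < l" "j < N"
  then have "i * N + j < Suc i * N" by simp
  also have "\<dots> \<le> l * N" using \<open>i < l\<close> by (intro mult_right_mono) auto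
  finally show ?thesis .
qed

lemma sr_weight_eq_card: "sr_weight N l c = card {i \<in> {..<l}. sr_block N c i \<noteq> 0\<^sub>v N}"
proof -
  have "sr_weight N l c = (\<Sum>i<l. if sr_block N c i \<noteq> 0\<^sub>v N then 1 else 0)"
    unfolding sr_weight_def by (intro sum.cong refl, subst rank_mat_of_row[OF sr_block_carrier]) simp
  then show ?thesis
    by (simp add: sum.If_cases Int_def)
qed

lemma sr_block_add:
  assumes "x \<in> carrier_vec (l * N)" "y \<in> carrier_vec (l * N)" "i < l"
  shows "sr_block N (x + y) i = sr_block N x i + sr_block N y i"
  using assms block_index_less[OF assms(3)] by (auto simp: sr_block_def)

lemma sr_block_diff:
  assumes "x \<in> carrier_vec (l * N)" "y \<in> carrier_vec (l * N)" "i < l"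
  shows "sr_block N (x - y) i = sr_block N x i - sr_block N y i"
  using assms block_index_less[OF assms(3)] by (auto simp: sr_block_def)

lemma sr_block_smult:
  assumes "x \<in> carrier_vec (l * N)" "i < l"
  shows "sr_block N (a \<cdot>\<^sub>v x) i = a \<cdot>\<^sub>v sr_block N x i"
  using assms block_index_less[OF assms(2)] by (auto simp: sr_block_def)

lemma sr_block_zero: "i < l \<Longrightarrow> sr_block N (0\<^sub>v (l * N)) i = 0\<^sub>v N"
  using block_index_less by (auto simp: sr_block_def)

lemma eq_vec_sr_blockI:
  assumes "x \<in> carrier_vec (l * N)" "y \<in> carrier_vec (l * N)"
    and "\<And>i. i < l \<Longrightarrow> sr_block N x i = sr_block N y i"
  shows "x = y"
proof (rule eq_vecI)
  fix k assume "k < dim_vec y"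
  then have k: "k < l * N" using assms by simp
  \<comment> \<open>Coordinate \<open>k\<close> is entry \<open>k mod N\<close> of block
    \<open>k div N\<close>; for \<open>N = 0\<close> there is no coordinate.\<close>
  then have "k div N < l" "k mod N < N"
    by (cases N; simp add: less_mult_imp_div_less)+
  then show "x $ k = y $ k"
    using assms(3)[of "k div N"] unfolding sr_block_def
    by (metis div_mult_mod_eq index_vec)
qed (use assms in simp)

lemma sr_weight_diff_le:
  assumes "x \<in> carrier_vec (l * N)" "y \<in> carrier_vec (l * N)"
  shows "sr_weight N l (x - y) \<le> sr_weight N l x + sr_weight N l y"
proof -
  have "{i \<in> {..<l}. sr_block N (x - y) i \<noteq> 0\<^sub>v N}
      \<subseteq> {i \<in> {..<l}. sr_block N x i \<noteq> 0\<^sub>v N} \<union> {i \<in> {..<l}. sr_block N y i \<noteq> 0\<^sub>v N}"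
    using assms by (auto simp: sr_block_diff)
  then have "card {i \<in> {..<l}. sr_block N (x - y) i \<noteq> 0\<^sub>v N}
      \<le> card ({i \<in> {..<l}. sr_block N x i \<noteq> 0\<^sub>v N} \<union> {i \<in> {..<l}. sr_block N y i \<noteq> 0\<^sub>v N})"
    by (intro card_mono) auto
  then show ?thesis
    unfolding sr_weight_eq_card using card_Un_le le_trans by blast
qed

lemma sr_weight_eq_0_iff:
  assumes "x \<in> carrier_vec (l * N)"
  shows "sr_weight N l x = 0 \<longleftrightarrow> x = 0\<^sub>v (l * N)"
  unfolding sr_weight_eq_card
  using eq_vec_sr_blockI[OF assms zero_carrier_vec] by (auto simp: sr_block_zero)

section \<open>The size of the ball of radius 1\<close>

definition embed_block :: "nat \<Rightarrow> nat \<Rightarrow> nat \<Rightarrow> 'a::zero vec \<Rightarrow> 'a vec" where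
  "embed_block N l i x = vec (l * N) (\<lambda>k. if k div N = i then x $ (k mod N) else 0)"

lemma embed_block_carrier [simp]: "embed_block N l i x \<in> carrier_vec (l * N)"
  by (simp add: embed_block_def)

lemma sr_block_embed_block:
  assumes "x \<in> carrier_vec N" "i' < l"
  shows "sr_block N (embed_block N l i x) i' = (if i' = i then x else 0\<^sub>v N)"
  using assms block_index_less[OF assms(2)] by (auto simp: sr_block_def embed_block_def)

text \<open>A vector of weight 1 amounts to the position and the content of its only nonzero block;
  the summand 1 is the zero vector.\<close>

lemma card_sr_ball_1:
  "card (sr_ball N l 1 :: 'a::{field,finite} vec set) = 1 + l * (card (UNIV :: 'a set) ^ N - 1)"
proof -
  let ?X = "{..<l} \<times> (carrier_vec N - {0\<^sub>v N :: 'a vec})"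
  have bij: "bij_betw (\<lambda>(i, x). embed_block N l i x) ?X (sr_ball N l 1 - {0\<^sub>v (l * N)})"
  proof (rule bij_betwI')
    fix p p' assume "p \<in> ?X" "p' \<in> ?X"
    then obtain i x j y where p: "p = (i, x)" "p' = (j, y)"
      and ij: "i < l" "j < l" "x \<in> carrier_vec N" "y \<in> carrier_vec N" "x \<noteq> 0\<^sub>v N"
      by auto
    have "i = j \<and> x = y" if "embed_block N l i x = embed_block N l j y"
      using arg_cong[OF that, of "\<lambda>c. sr_block N c i"] ij
      by (auto simp: sr_block_embed_block split: if_splits)
    then show "((case p of (i, x) \<Rightarrow> embed_block N l i x) = (case p' of (i, x) \<Rightarrow> embed_block N l i x)) \<longleftrightarrow> p = p'"
      by (auto simp: p)
  next
    fix p assume "p \<in> ?X"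
    then obtain i x where p: "p = (i, x)" and ix: "i < l" "x \<in> carrier_vec N" "x \<noteq> 0\<^sub>v N"
      by auto
    have "{i' \<in> {..<l}. sr_block N (embed_block N l i x) i' \<noteq> 0\<^sub>v N} = {i}"
      using ix by (auto simp: sr_block_embed_block)
    then have "sr_weight N l (embed_block N l i x) = 1"
      by (simp add: sr_weight_eq_card)
    then show "(case p of (i, x) \<Rightarrow> embed_block N l i x) \<in> sr_ball N l 1 - {0\<^sub>v (l * N)}"
      using sr_weight_eq_0_iff[of "0\<^sub>v (l * N) :: 'a vec" l N] by (auto simp: p sr_ball_def)
  next
    fix b :: "'a vec" assume b: "b \<in> sr_ball N l 1 - {0\<^sub>v (l * N)}"
    then have "sr_weight N l b = 1"
      using sr_weight_eq_0_iff[of b l N] by (auto simp: sr_ball_def)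
    then obtain i where i: "{i \<in> {..<l}. sr_block N b i \<noteq> 0\<^sub>v N} = {i}"
      by (auto simp: sr_weight_eq_card card_1_singleton_iff)
    have "b = embed_block N l i (sr_block N b i)"
    proof (rule eq_vec_sr_blockI)
      show "b \<in> carrier_vec (l * N)" using b by (simp add: sr_ball_def)
    qed (use i in \<open>auto simp: sr_block_embed_block\<close>)
    then show "\<exists>p\<in>?X. b = (case p of (i, x) \<Rightarrow> embed_block N l i x)"
      using i by (intro bexI[of _ "(i, sr_block N b i)"]) auto
  qed
  have "0\<^sub>v (l * N) \<in> (sr_ball N l 1 :: 'a vec set)"
    using sr_weight_eq_0_iff[of "0\<^sub>v (l * N) :: 'a vec" l N] by (simp add: sr_ball_def)
  moreover have fin: "finite (sr_ball N l 1 :: 'a vec set)"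
    by (rule finite_subset[OF _ finite_carrier_vec]) (auto simp: sr_ball_def)
  ultimately have "card (sr_ball N l 1 :: 'a vec set) = 1 + card (sr_ball N l 1 - {0\<^sub>v (l * N) :: 'a vec})"
    using card.remove[OF fin] by simp
  also have "card (sr_ball N l 1 - {0\<^sub>v (l * N) :: 'a vec}) = card ?X"
    using bij_betw_same_card[OF bij] by simp
  also have "\<dots> = l * (card (UNIV :: 'a set) ^ N - 1)"
    by (simp add: card_cartesian_product card_Diff_singleton card_carrier_vec)
  finally show ?thesis .
qed

text \<open>A nonzero code has a nonempty finite set of weights, so \<open>Min\<close> is a genuine
  minimum.\<close>

lemma le_sr_distance_iff:
  assumes "nonzero_linear_code (l * N) (C :: 'a::{field,finite} vec set)"
  shows "k \<le> sr_distance N l C \<longleftrightarrow> (\<forall>c\<in>C - {0\<^sub>v (l * N)}. k \<le> sr_weight N l c)"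
proof -
  have "C \<subseteq> carrier_vec (l * N)" "C - {0\<^sub>v (l * N)} \<noteq> {}"
    using assms linear_codeD(1,2)[of "l * N" C] by (auto simp: nonzero_linear_code_def)
  then have "finite C" using finite_carrier_vec finite_subset by blast
  then show ?thesis
    using \<open>C - {0\<^sub>v (l * N)} \<noteq> {}\<close> unfolding sr_distance_def by (subst Min_ge_iff) auto
qed

section \<open>Sphere packing\<close>

text \<open>If \<open>c + b = c' + b'\<close>, then the codeword \<open>c - c' = b' - b\<close> has
  weight at most 2 and is therefore zero. Injectivity expresses that the unit balls around the
  codewords are disjoint.\<close>

lemma sr_ball_1_translates:
  assumes "linear_code (l * N) C" "\<And>c. c \<in> C \<Longrightarrow> c \<noteq> 0\<^sub>v (l * N) \<Longrightarrow> 3 \<le> sr_weight N l c"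
  shows "inj_on (\<lambda>(c, b). c + b) (C \<times> sr_ball N l 1 :: ('a::field vec \<times> 'a vec) set)"
    and "(\<lambda>(c, b). c + b) ` (C \<times> sr_ball N l 1) \<subseteq> carrier_vec (l * N)"
proof -
  have carrier: "c \<in> C \<Longrightarrow> c \<in> carrier_vec (l * N)" "b \<in> sr_ball N l 1 \<Longrightarrow> b \<in> carrier_vec (l * N)" for b c :: "'a vec"
    using linear_codeD(1)[OF assms(1)] by (auto simp: sr_ball_def)
  show "(\<lambda>(c, b). c + b) ` (C \<times> sr_ball N l 1) \<subseteq> carrier_vec (l * N)"
    using carrier by (auto intro!: add_carrier_vec)
  show "inj_on (\<lambda>(c, b). c + b) (C \<times> sr_ball N l 1)"
  proof (rule inj_onI, clarify)
    fix c b c' b'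
    assume *: "c \<in> C" "b \<in> sr_ball N l 1" "c' \<in> C" "b' \<in> sr_ball N l 1" "c + b = c' + b'"
    note cs = carrier(1)[OF *(1)] carrier(2)[OF *(2)] carrier(1)[OF *(3)] carrier(2)[OF *(4)]
    have eq: "c $ i + b $ i = c' $ i + b' $ i" if "i < l * N" for i
      using arg_cong[OF *(5), of "\<lambda>v. vec_index v i"] that cs by auto
    have "c - c' = b' - b"
    proof (rule eq_vecI)
      fix i assume "i < dim_vec (b' - b)"
      then have i: "i < l * N" using cs by simp
      from eq[OF i] have "c $ i - c' $ i = b' $ i - b $ i"
        by (metis add_diff_cancel_left' add_diff_eq diff_add_eq diff_diff_eq2)
      then show "(c - c') $ i = (b' - b) $ i" using i cs by simp
    qed (use cs in auto)
    then have "sr_weight N l (c - c') \<le> 2"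
      using sr_weight_diff_le[OF cs(4,2)] *(2,4) by (simp add: sr_ball_def)
    then have diff: "c - c' = 0\<^sub>v (l * N)"
      using assms(2)[of "c - c'"] linear_codeD(5)[OF assms(1) *(1,3)] by fastforce
    have "c = c'"
    proof (rule eq_vecI)
      show "c $ i = c' $ i" if "i < dim_vec c'" for i
        using arg_cong[OF diff, of "\<lambda>v. vec_index v i"] that cs by auto
    qed (use cs in auto)
    moreover have "b = b'"
      using cs eq \<open>c = c'\<close> by (intro eq_vecI) auto
    ultimately show "c = c' \<and> b = b'" by simp
  qed
qed

text \<open>The Hamming bound: the disjoint translates of the ball fit into the whole space.\<close>

lemma sphere_packing:
  assumes "linear_code (l * N) (C :: 'a::{field,finite} vec set)"
    and "\<And>c. c \<in> C \<Longrightarrow> c \<noteq> 0\<^sub>v (l * N) \<Longrightarrow> 3 \<le> sr_weight N l c"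
  shows "card C * (1 + l * (card (UNIV :: 'a set) ^ N - 1)) \<le> card (UNIV :: 'a set) ^ (l * N)"
  using card_mono[OF finite_carrier_vec sr_ball_1_translates(2)[OF assms]]
    card_image[OF sr_ball_1_translates(1)[OF assms]]
  by (simp add: card_sr_ball_1 card_cartesian_product card_carrier_vec del: One_nat_def)

section \<open>Codes from Desarguesian spreads\<close>

text \<open>A counting form of rank-nullity: subtracting a fixed element of a fiber of
  \<open>T\<close> maps that fiber injectively into \<open>K\<close>, and the fibers over
  \<open>W\<close> cover the space.\<close>

lemma card_le_card_kernel_mult_card_image:
  fixes K :: "'a::{ab_group_add,finite} vec set"
  assumes "K \<subseteq> carrier_vec n" "finite W"
    and "\<And>x. x \<in> carrier_vec n \<Longrightarrow> T x \<in> W"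
    and "\<And>x y. x \<in> carrier_vec n \<Longrightarrow> y \<in> carrier_vec n \<Longrightarrow> T x = T y \<Longrightarrow> x - y \<in> K"
  shows "card (carrier_vec n :: 'a vec set) \<le> card K * card W"
proof -
  define fiber where "fiber w = {x \<in> carrier_vec n. T x = w}" for w
  have "card (fiber w) \<le> card K" for w
  proof (cases "fiber w = {}")
    case False
    then obtain y where y: "y \<in> carrier_vec n" "T y = w" by (auto simp: fiber_def)
    have "inj_on (\<lambda>x. x - y) (fiber w)"
    proof (rule inj_onI)
      fix x x' assume x: "x \<in> fiber w" "x' \<in> fiber w" and eq: "x - y = x' - y"
      have "x $ i = x' $ i" if "i < n" for i
        using arg_cong[OF eq, of "\<lambda>v. vec_index v i"] that x y by (auto simp: fiber_def)
      then show "x = x'" using x by (intro eq_vecI) (auto simp: fiber_def)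
    qed
    moreover have "(\<lambda>x. x - y) ` fiber w \<subseteq> K"
      using assms(4) y by (auto simp: fiber_def)
    moreover have "finite K" using assms(1) finite_carrier_vec finite_subset by blast
    ultimately show ?thesis by (rule card_inj_on_le)
  qed simp
  then have "(\<Sum>w\<in>W. card (fiber w)) \<le> card K * card W"
    using sum_bounded_above[of W "\<lambda>w. card (fiber w)" "card K"] by (simp add: mult.commute)
  moreover have "card (carrier_vec n :: 'a vec set) \<le> (\<Sum>w\<in>W. card (fiber w))"
  proof -
    have "carrier_vec n = (\<Union>w\<in>W. fiber w)" using assms(3) by (auto simp: fiber_def)
    then show ?thesis using card_UN_le[OF assms(2), of fiber] by simp
  qed
  ultimately show ?thesis by simp
qed

text \<open>Representatives of the points of the projective space of dimension \<open>s - 1\<close> over \<open>F\<close>, normalized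
  so that the last nonzero coordinate is \<open>1\<close>.\<close>

definition projective_points :: "nat \<Rightarrow> 'b::field set \<Rightarrow> (nat \<Rightarrow> 'b) set" where
  "projective_points s F =
    (\<Union>k<s. PiE {..<s} (\<lambda>j. if j < k then F else if j = k then {1} else {0}))"

lemma projective_pointsE:
  assumes "v \<in> projective_points s F"
  obtains k where "k < s" "v k = 1" "\<And>j. k < j \<Longrightarrow> j < s \<Longrightarrow> v j = 0"
proof -
  from assms obtain k where k: "k < s"
    "v \<in> PiE {..<s} (\<lambda>j. if j < k then F else if j = k then {1} else {0})"
    by (auto simp: projective_points_def)
  show ?thesis
  proof (rule that[OF k(1)])
    show "v k = 1" using PiE_mem[OF k(2), of k] k(1) by simp
    show "v j = 0" if "k < j" "j < s" for j
      using PiE_mem[OF k(2), of j] that by simp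
  qed
qed

lemma projective_points_mem:
  assumes "v \<in> projective_points s F" "j < s" "0 \<in> F" "1 \<in> F"
  shows "v j \<in> F"
  using assms by (force simp: projective_points_def PiE_iff split: if_splits)

text \<open>A last nonzero coordinate at position \<open>k\<close> leaves \<open>k\<close> free
  coordinates before it, and different positions give disjoint families.\<close>

lemma card_projective_points:
  assumes "finite F"
  shows "card (projective_points s F) = (\<Sum>k<s. card F ^ k)"
proof -
  let ?P = "\<lambda>k. PiE {..<s} (\<lambda>j. if j < k then F else if j = k then {1} else {0})"
  have "card (?P k) = card F ^ k" if "k < s" for k
  proof -
    have "card (?P k) = (\<Prod>j<s. if j < k then card F else 1)"
      by (simp add: card_PiE) (intro prod.cong, auto)
    also have "\<dots> = (\<Prod>j\<in>{j \<in> {..<s}. j < k}. card F)"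
      by (simp add: prod.If_cases Int_def)
    also have "{j \<in> {..<s}. j < k} = {..<k}" using that by auto
    finally show ?thesis by simp
  qed
  moreover have disj: "?P k \<inter> ?P k' = {}" if "k < k'" "k' < s" for k k'
  proof -
    \<comment> \<open>At coordinate \<open>k'\<close> the first family forces 0 and the second
      forces 1.\<close>
    have False if v: "v \<in> ?P k" "v \<in> ?P k'" for v
      using PiE_mem[OF v(1), of k'] PiE_mem[OF v(2), of k'] \<open>k < k'\<close> \<open>k' < s\<close> by simp
    then show ?thesis by blast
  qed
  have "?P k \<inter> ?P k' = {}" if "k < s" "k' < s" "k \<noteq> k'" for k k'
    using that disj[of k k'] disj[of k' k] by (cases k k' rule: linorder_cases) auto
  then have "card (projective_points s F) = (\<Sum>k<s. card (?P k))"
    unfolding projective_points_def using assms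
    by (intro card_UN_disjoint) (auto intro!: finite_PiE)
  ultimately show ?thesis by simp
qed

text \<open>Compare the positions of the final ones. If they differ, the later one isolates one
  coefficient and the earlier one then the other. If they agree, \<open>b = - a\<close>, and a
  coordinate where the points differ forces \<open>a = 0\<close>.\<close>

lemma projective_points_independent:
  assumes v: "v \<in> projective_points s F" and w: "w \<in> projective_points s F" and "v \<noteq> w"
    and eq: "\<And>t. t < s \<Longrightarrow> a * v t + b * w t = 0"
  shows "a = 0 \<and> b = 0"
proof -
  obtain k where k: "k < s" "v k = 1" "\<And>j. k < j \<Longrightarrow> j < s \<Longrightarrow> v j = 0"
    using projective_pointsE[OF v] by metis
  obtain m where m: "m < s" "w m = 1" "\<And>j. m < j \<Longrightarrow> j < s \<Longrightarrow> w j = 0"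
    using projective_pointsE[OF w] by metis
  consider "k < m" | "m < k" | "k = m" by linarith
  then show ?thesis
  proof cases
    case 1
    then show ?thesis using eq[OF k(1)] eq[OF m(1)] k m by auto
  next
    case 2
    then show ?thesis using eq[OF k(1)] eq[OF m(1)] k m by auto
  next
    case 3
    then have b: "b = - a" using eq[OF k(1)] k m by (simp add: eq_neg_iff_add_eq_0 add.commute)
    have ext: "v \<in> extensional {..<s}" "w \<in> extensional {..<s}"
      using v w by (auto simp: projective_points_def PiE_def)
    obtain t where "t < s" "v t \<noteq> w t"
      using extensionalityI[OF ext] \<open>v \<noteq> w\<close> by blast
    moreover have "a * (v t - w t) = 0" if "t < s"
      using eq[OF that] b by (simp add: algebra_simps)
    ultimately show ?thesis using b by auto
  qed
qed

text \<open>The columns of the parity-check matrix come from the Desarguesian spread: block \<open>i\<close> contributes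
  the line spanned by the \<open>i\<close>-th projective point over the field with \<open>q ^ N\<close> elements, viewed as an
  \<open>N\<close>-dimensional space over the field with \<open>q\<close> elements.\<close>

lemma exists_spread_code:
  fixes N s :: nat
  defines "q \<equiv> card (UNIV :: 'a::{field,finite} set)"
  defines "L \<equiv> \<Sum>k<s. (q ^ N) ^ k"
  assumes "N > 0"
  shows "\<exists>C :: 'a vec set. linear_code (L * N) C \<and>
    (\<forall>c\<in>C. c \<noteq> 0\<^sub>v (L * N) \<longrightarrow> 3 \<le> sr_weight N L c) \<and> q ^ (L * N) \<le> card C * q ^ (N * s)"
proof -
  let ?F = "frobenius_fixed N :: 'a alg_closure set"
  \<comment> \<open>The \<open>N\<close> independent elements make \<open>\<iota>\<close> below an
    injective linear map from blocks into \<open>?F\<close>.\<close>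
  obtain b where b: "\<And>j. j < N \<Longrightarrow> b j \<in> ?F"
    "\<And>x :: nat \<Rightarrow> 'a. (\<Sum>j<N. to_ac (x j) * b j) = 0 \<Longrightarrow> \<forall>j<N. x j = 0"
    using exists_independent_in_frobenius_fixed[of N N] assms(3) by blast
  define \<iota> where "\<iota> v = (\<Sum>j<N. to_ac (vec_index v j) * b j)" for v :: "'a vec"
  have \<iota>_0D: "v = 0\<^sub>v N" if "\<iota> v = 0" "v \<in> carrier_vec N" for v
  proof (rule eq_vecI)
    fix j assume "j < dim_vec (0\<^sub>v N :: 'a vec)"
    then show "v $ j = 0\<^sub>v N $ j"
      using b(2)[of "vec_index v"] that(1) unfolding \<iota>_def by simp
  qed (use that(2) in simp)
  have \<iota>_add: "\<iota> (v + w) = \<iota> v + \<iota> w" and \<iota>_diff: "\<iota> (v - w) = \<iota> v - \<iota> w"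
    if "v \<in> carrier_vec N" "w \<in> carrier_vec N" for v w
    using that by (simp_all add: \<iota>_def algebra_simps sum.distrib sum_subtractf)
  have \<iota>_smult: "\<iota> (a \<cdot>\<^sub>v v) = to_ac a * \<iota> v" if "v \<in> carrier_vec N" for v a
    using that by (simp add: \<iota>_def sum_distrib_left mult.assoc)
  have \<iota>_0: "\<iota> (0\<^sub>v N) = 0" by (simp add: \<iota>_def)
  have \<iota>_F: "\<iota> v \<in> ?F" for v
    unfolding \<iota>_def
    by (intro sum_in_frobenius_fixed frobenius_fixed_closed(2) to_ac_in_frobenius_fixed b(1)) simp
  have "card (projective_points s ?F) = L"
    unfolding L_def q_def using assms(3)
    by (simp add: card_projective_points finite_frobenius_fixed card_frobenius_fixed)
  moreover have "finite (projective_points s ?F)"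
    unfolding projective_points_def using finite_frobenius_fixed[OF assms(3)]
    by (auto intro!: finite_PiE)
  ultimately obtain h where h: "bij_betw h {..<L} (projective_points s ?F)"
    using ex_bij_betw_nat_finite by (metis atLeast0LessThan)
  have hP: "h i \<in> projective_points s ?F" if "i < L" for i
    using h that by (auto simp: bij_betw_def)
  \<comment> \<open>The syndrome, written with \<open>s\<close> coordinates in \<open>?F\<close>
    instead of \<open>N * s\<close> coordinates in the base field; \<open>h i\<close> is the
    projective point attached to block \<open>i\<close>.\<close>
  define synd where "synd c t = (\<Sum>i<L. \<iota> (sr_block N c i) * h i t)" for c t
  have synd_add: "synd (x + y) t = synd x t + synd y t"
    and synd_diff: "synd (x - y) t = synd x t - synd y t"
    if "x \<in> carrier_vec (L * N)" "y \<in> carrier_vec (L * N)" for x y t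
    using that
    by (simp_all add: synd_def sr_block_add[where l=L] sr_block_diff[where l=L] \<iota>_add \<iota>_diff algebra_simps
      sum.distrib sum_subtractf)
  have synd_smult: "synd (a \<cdot>\<^sub>v x) t = to_ac a * synd x t" if "x \<in> carrier_vec (L * N)" for a x t
    using that by (simp add: synd_def sr_block_smult[where l=L] \<iota>_smult sum_distrib_left mult.assoc)
  define C where "C = {c \<in> carrier_vec (L * N). \<forall>t<s. synd c t = 0}"
  have "linear_code (L * N) C"
    unfolding linear_code_iff
    by (auto simp: C_def synd_add synd_smult add_carrier_vec) (simp add: synd_def sr_block_zero \<iota>_0)
  moreover have "c = 0\<^sub>v (L * N)" if "c \<in> C" "\<not> 3 \<le> sr_weight N L c" for c
  proof -
    define S where "S = {i \<in> {..<L}. sr_block N c i \<noteq> 0\<^sub>v N}"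
    have cs: "c \<in> carrier_vec (L * N)" "\<And>t. t < s \<Longrightarrow> synd c t = 0"
      using that by (auto simp: C_def)
    have nz: "\<iota> (sr_block N c i) \<noteq> 0" if "i \<in> S" for i
      using that \<iota>_0D[of "sr_block N c i"] by (auto simp: S_def)
    have S: "finite S" "S \<subseteq> {..<L}" by (auto simp: S_def)
    have synd_S: "(\<Sum>i\<in>S. \<iota> (sr_block N c i) * h i t) = 0" if "t < s" for t
    proof -
      have "(\<Sum>i\<in>S. \<iota> (sr_block N c i) * h i t) = synd c t"
        unfolding synd_def by (rule sum.mono_neutral_left) (auto simp: S_def \<iota>_0)
      then show ?thesis using cs(2)[OF that] by simp
    qed
    \<comment> \<open>A projective point has a coordinate equal to 1, where a single term cannot
      vanish.\<close>
    have "card S \<noteq> 1"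
    proof
      assume "card S = 1"
      then obtain i where i: "S = {i}" by (auto simp: card_1_singleton_iff)
      then have "i < L" using S by auto
      obtain k where "k < s" "h i k = 1" using projective_pointsE[OF hP[OF \<open>i < L\<close>]] by metis
      then show False using synd_S[of k] nz[of i] i by simp
    qed
    \<comment> \<open>Two nonzero blocks would be a dependence between distinct projective
      points.\<close>
    moreover have "card S \<noteq> 2"
    proof
      assume "card S = 2"
      then obtain i j where ij: "S = {i, j}" "i \<noteq> j" by (auto simp: card_2_iff)
      then have "i < L" "j < L" using S by auto
      have "h i \<noteq> h j"
        using h ij(2) \<open>i < L\<close> \<open>j < L\<close> by (auto simp: bij_betw_def inj_on_def)
      moreover have "\<iota> (sr_block N c i) * h i t + \<iota> (sr_block N c j) * h j t = 0" if "t < s" for t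
        using synd_S[OF that] ij by simp
      ultimately have "\<iota> (sr_block N c i) = 0"
        using projective_points_independent[OF hP[OF \<open>i < L\<close>] hP[OF \<open>j < L\<close>]] by blast
      then show False using nz[of i] ij by simp
    qed
    moreover have "card S < 3" using that(2) by (simp add: sr_weight_eq_card S_def)
    ultimately have "card S = 0" by linarith
    then show ?thesis
      using sr_weight_eq_0_iff[OF cs(1)] by (simp add: sr_weight_eq_card S_def)
  qed
  moreover have "q ^ (L * N) \<le> card C * q ^ (N * s)"
  proof -
    \<comment> \<open>There are \<open>q ^ (N * s)\<close> possible syndromes, so the redundancy is
      at most \<open>N * s\<close>.\<close>
    let ?W = "PiE {..<s} (\<lambda>_. ?F)"
    have "card (carrier_vec (L * N) :: 'a vec set) \<le> card C * card ?W"
    proof (rule card_le_card_kernel_mult_card_image[where T = "\<lambda>c. restrict (synd c) {..<s}"])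
      show "C \<subseteq> carrier_vec (L * N)" by (auto simp: C_def)
      show "finite ?W" using finite_frobenius_fixed[OF assms(3)] by (intro finite_PiE) auto
      have "synd c t \<in> ?F" if "t < s" for c t
        unfolding synd_def using that
        by (intro sum_in_frobenius_fixed frobenius_fixed_closed(2) \<iota>_F projective_points_mem[OF hP]) auto
      then show "restrict (synd c) {..<s} \<in> ?W" for c by auto
      show "x - y \<in> C" if xy: "x \<in> carrier_vec (L * N)" "y \<in> carrier_vec (L * N)"
        and eq: "restrict (synd x) {..<s} = restrict (synd y) {..<s}" for x y
      proof -
        have "synd x t = synd y t" if "t < s" for t
          using fun_cong[OF eq, of t] that by simp
        then show ?thesis using xy by (simp add: C_def synd_diff)
      qed
    qed
    also have "card ?W = q ^ (N * s)"
      by (simp add: card_PiE card_frobenius_fixed[OF assms(3)] q_def power_mult)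
    finally show ?thesis by (simp add: card_carrier_vec q_def)
  qed
  ultimately show ?thesis by blast
qed

section \<open>Perfectness\<close>

text \<open>The geometric sum, rearranged so that its left side is the size of a unit ball;
  \<open>Q = Suc P\<close> removes the truncated subtraction.\<close>

lemma sum_powers_mult_pred:
  fixes Q :: nat
  assumes "1 \<le> Q"
  shows "1 + (\<Sum>k<s. Q ^ k) * (Q - 1) = Q ^ s"
proof -
  obtain P where "Q = Suc P" using assms by (cases Q) auto
  then show ?thesis by (induction s) (simp_all add: algebra_simps)
qed

text \<open>By perfectness a vector \<open>e\<close> of weight 2 is \<open>c + b\<close> with
  \<open>b\<close> in the unit ball, so \<open>c\<close> has weight at most 3. At distance 4 or more
  this forces \<open>c = 0\<close>, and then \<open>e = b\<close> has weight at most 1.\<close>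

lemma sr_distance_le_3_if_perfect:
  fixes C :: "'a::{field,finite} vec set"
  assumes C: "nonzero_linear_code (l * N) C" "3 \<le> sr_distance N l C"
    and perfect: "card C * card (sr_ball N l 1 :: 'a vec set) = card (carrier_vec (l * N) :: 'a vec set)"
    and "2 \<le> l" "N > 0"
  shows "sr_distance N l C \<le> 3"
proof (rule ccontr)
  assume "\<not> sr_distance N l C \<le> 3"
  then have dist: "4 \<le> sr_weight N l c" if "c \<in> C" "c \<noteq> 0\<^sub>v (l * N)" for c
    using le_sr_distance_iff[OF C(1), of 4] that by auto
  have lin: "linear_code (l * N) C" using C(1) by (simp add: nonzero_linear_code_def)
  have dist3: "3 \<le> sr_weight N l c" if "c \<in> C" "c \<noteq> 0\<^sub>v (l * N)" for c
    using dist[OF that] by simp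
  \<comment> \<open>The translates are disjoint and have the right total size, so they fill the
    space.\<close>
  have cover: "(\<lambda>(c, b). c + b) ` (C \<times> sr_ball N l 1) = carrier_vec (l * N)"
    using card_image[OF sr_ball_1_translates(1)[OF lin dist3]] perfect
    by (intro card_subset_eq finite_carrier_vec sr_ball_1_translates(2)[OF lin dist3])
      (simp_all add: card_cartesian_product)
  define u :: "'a vec" where "u = vec N (\<lambda>_. 1)"
  have u: "u \<in> carrier_vec N" "u \<noteq> 0\<^sub>v N"
    using \<open>N > 0\<close> by (auto simp: u_def vec_eq_iff)
  define e where "e = embed_block N l 0 u + embed_block N l 1 u"
  have e: "e \<in> carrier_vec (l * N)" by (auto simp: e_def intro!: add_carrier_vec)
  have "{i \<in> {..<l}. sr_block N e i \<noteq> 0\<^sub>v N} = {0, 1}"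
    using u \<open>2 \<le> l\<close>
    by (auto simp: e_def sr_block_add[where l = l] sr_block_embed_block split: if_splits)
  then have wt_e: "sr_weight N l e = 2" by (simp add: sr_weight_eq_card)
  obtain c b where cb: "c \<in> C" "b \<in> sr_ball N l 1" "e = c + b"
    using e unfolding cover[symmetric] by auto
  have carrier: "c \<in> carrier_vec (l * N)" "b \<in> carrier_vec (l * N)"
    using cb linear_codeD(1)[OF lin] by (auto simp: sr_ball_def)
  have "e - b = c" using carrier cb(3) by (intro eq_vecI) auto
  then have "sr_weight N l c \<le> 3"
    using sr_weight_diff_le[OF e carrier(2)] wt_e cb(2) by (simp add: sr_ball_def)
  then have "c = 0\<^sub>v (l * N)" using dist[OF cb(1)] by fastforce
  then have "e = b" using cb(3) carrier by simp
  then show False using wt_e cb(2) by (simp add: sr_ball_def)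
qed

theorem corollary15:
  fixes C :: "'a::{field,finite} vec set" and q l N r :: nat
  assumes "card (UNIV :: 'a set) = q"
    and "l > 0" and "N > 0"
    and "N \<le> r" and "N dvd r"
    and "proper_sr_hamming_code N l C"
    and "r = redundancy (l * N) C"
  shows "sr_perfect N l C \<and>
    card C * card (sr_ball N l 1 :: 'a vec set) = card (carrier_vec (l * N) :: 'a vec set) \<and>
    sr_correction_capability N l C = 1"
proof -
  note q = assms(1)
  have q2: "2 \<le> q" using card_UNIV_ge_2[where 'a='a] q by simp
  have Q1: "1 \<le> q ^ N" using q2 by simp
  have C: "nonzero_linear_code (l * N) C" "3 \<le> sr_distance N l C"
    and maximal: "\<And>l' C'. l < l' \<Longrightarrow> nonzero_linear_code (l' * N) (C' :: 'a vec set) \<Longrightarrow>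
      3 \<le> sr_distance N l' C' \<Longrightarrow> redundancy (l' * N) C' \<noteq> redundancy (l * N) C"
    using assms(6) unfolding proper_sr_hamming_code_def by blast+
  have lin: "linear_code (l * N) C" using C(1) by (simp add: nonzero_linear_code_def)
  have dist: "3 \<le> sr_weight N l c" if "c \<in> C" "c \<noteq> 0\<^sub>v (l * N)" for c
    using le_sr_distance_iff[OF C(1), of 3] C(2) that by blast
  obtain s where s: "r = N * s" using assms(5) by (elim dvdE)
  define L where "L = (\<Sum>k<s. (q ^ N) ^ k)"
  have L: "1 + L * (q ^ N - 1) = q ^ r"
    unfolding L_def s power_mult by (rule sum_powers_mult_pred[OF Q1])
  have Q_gt: "0 < q ^ N - 1"
    using one_less_power[of q N] q2 \<open>N > 0\<close> by simp
  have cardC: "card C = q ^ code_dim (l * N) C" using card_linear_code[OF lin] q by simp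
  \<comment> \<open>This bound ensures that the subtraction in \<open>redundancy\<close> does not
    truncate.\<close>
  have "card C \<le> q ^ (l * N)"
    using card_mono[OF finite_carrier_vec linear_codeD(1)[OF lin]] q by (simp add: card_carrier_vec)
  then have "code_dim (l * N) C \<le> l * N" using q2 by (simp add: cardC)
  then have dim: "code_dim (l * N) C + r = l * N" using assms(7) by (simp add: redundancy_def)
  have "card C \<noteq> 1"
    using C(1) linear_codeD(2)[OF lin] by (auto simp: card_1_singleton_iff nonzero_linear_code_def)
  then have "code_dim (l * N) C > 0" using cardC by (cases "code_dim (l * N) C") auto
  then have "r < l * N" using dim by simp
  \<comment> \<open>Since \<open>card C * q ^ r = q ^ (l * N)\<close>, the Hamming bound compares
    the unit ball with \<open>q ^ r\<close>, which is the ball size for \<open>L\<close>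
    blocks.\<close>
  have "card C * (1 + l * (q ^ N - 1)) \<le> card C * q ^ r"
    using sphere_packing[OF lin dist] unfolding q cardC power_add[symmetric] dim by simp
  then have "l * (q ^ N - 1) \<le> L * (q ^ N - 1)"
    using q2 unfolding L[symmetric] by (subst (asm) mult_le_cancel1) (simp add: cardC)
  then have "l \<le> L" using Q_gt by simp
  moreover have "\<not> l < L"
  proof
    assume "l < L"
    obtain D :: "'a vec set" where D: "linear_code (L * N) D"
      "\<And>c. c \<in> D \<Longrightarrow> c \<noteq> 0\<^sub>v (L * N) \<Longrightarrow> 3 \<le> sr_weight N L c"
      "q ^ (L * N) \<le> card D * q ^ r"
      using exists_spread_code[OF \<open>N > 0\<close>, where 'a='a and s=s] unfolding q L_def s by blast
    have cardD: "card D = q ^ code_dim (L * N) D" using card_linear_code[OF D(1)] q by simp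
    \<comment> \<open>The Hamming bound is the converse of the lower bound on \<open>card D\<close>,
      so the redundancy of \<open>D\<close> is exactly \<open>r\<close>.\<close>
    have "card D * q ^ r \<le> q ^ (L * N)"
      using sphere_packing[OF D(1,2)] unfolding q L by simp
    with D(3) have "q ^ (code_dim (L * N) D + r) = q ^ (L * N)"
      by (simp add: cardD power_add)
    then have dimD: "code_dim (L * N) D + r = L * N"
      using q2 by (simp add: power_inject_exp)
    \<comment> \<open>\<open>D\<close> is longer than \<open>C\<close> and \<open>C\<close> is
      already longer than \<open>r\<close>, so \<open>D\<close> is not the zero code.\<close>
    have "l * N \<le> L * N" using \<open>l < L\<close> by simp
    then have "code_dim (L * N) D \<noteq> 0" using dimD \<open>r < l * N\<close> by linarith
    then have "card D \<noteq> 1" using cardD q2 by simp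
    then have nonzero: "nonzero_linear_code (L * N) D"
      using D(1) by (auto simp: nonzero_linear_code_def)
    have "3 \<le> sr_distance N L D"
      using D(2) by (simp add: le_sr_distance_iff[OF nonzero])
    moreover have "redundancy (L * N) D = redundancy (l * N) C"
      using dimD assms(7) by (simp add: redundancy_def)
    ultimately show False using maximal[OF \<open>l < L\<close> nonzero] by blast
  qed
  ultimately have "l = L" by simp
  have perfect: "card C * card (sr_ball N l 1 :: 'a vec set) = card (carrier_vec (l * N) :: 'a vec set)"
    unfolding card_sr_ball_1 card_carrier_vec q \<open>l = L\<close> L
    using dim \<open>l = L\<close> by (simp add: cardC flip: power_add)
  \<comment> \<open>A single block would give \<open>r < N\<close>.\<close>
  have "2 \<le> l"
  proof (rule ccontr)
    assume "\<not> 2 \<le> l"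
    then have "l * N \<le> 1 * N" by (intro mult_right_mono) auto
    then show False using \<open>r < l * N\<close> \<open>N \<le> r\<close> by linarith
  qed
  then have "sr_distance N l C = 3"
    using sr_distance_le_3_if_perfect[OF C perfect _ \<open>N > 0\<close>] C(2) by simp
  then have "sr_correction_capability N l C = 1"
    by (simp add: sr_correction_capability_def)
  then show ?thesis using perfect by (simp add: sr_perfect_def)
qed

end
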